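(* Let $C,\gamma>0$. There exist constants $C_{\rm LU}>0$ and $p>2$ (depending only on $C,\gamma$) such that for every $n\in\mathbb{N}$ and every $M\in\mathbb{R}^{n\times n}$ with $\|M\|_{S_\infty}\le C$ and $\max_{1\le j\le n}\|(M|_{j\times j})^{-1}\|_{S_\infty}\le1/\gamma$, $M$ has an $LU$-factorization $M=LU$ with $L$ unit lower triangular ($L_{ii}=1$) and $U$ upper triangular satisfying $$\|L\|_{S_\infty}+\|U\|_{S_\infty}+\|L^{-1}\|_{S_\infty}+\|U^{-1}\|_{S_\infty}\le C_{\rm LU}\,n^{1/p}.$$
   Context: $\|\cdot\|_{S_\infty}$ denotes the spectral norm; $M|_{j\times j}$ is the upper left $j\times j$ submatrix of $M$ (assumed invertible for all $j$). *)

theory Defs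
  imports Complex_Main "Jordan_Normal_Form.Matrix"
begin

definition vec_l2 :: "real vec \<Rightarrow> real" where
  "vec_l2 v = sqrt (\<Sum>i<dim_vec v. (v $ i)^2)"

definition spec_norm :: "real mat \<Rightarrow> real" where
  "spec_norm A = Sup {vec_l2 (A *\<^sub>v v) | v. v \<in> carrier_vec (dim_col A) \<and> vec_l2 v \<le> 1}"

definition ul_sub :: "'a mat \<Rightarrow> nat \<Rightarrow> 'a mat" where
  "ul_sub M j = mat j j (\<lambda>(a,b). M $$ (a,b))"

definition is_inverse_of :: "real mat \<Rightarrow> real mat \<Rightarrow> bool" where
  "is_inverse_of B A \<longleftrightarrow> square_mat A \<and> B \<in> carrier_mat (dim_row A) (dim_row A)
     \<and> inverts_mat A B \<and> inverts_mat B A"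

definition unit_lower_triangular :: "real mat \<Rightarrow> bool" where
  "unit_lower_triangular L \<longleftrightarrow> (\<forall>i<dim_row L. \<forall>j<dim_col L. i < j \<longrightarrow> L $$ (i,j) = 0)
     \<and> (\<forall>i<dim_row L. L $$ (i,i) = 1)"

end

theory Submission
  imports Defs "HOL-Analysis.Generalised_Binomial_Theorem" "Jordan_Normal_Form.Determinant"
begin

text \<open>
  For a vector $z$ let $y^k$ be the Galerkin solution of $M y = z$ on the first $k$ coordinates,
  padded with zeros. Its last entry is the product of the last row of $M_k^{-1}$ with $z$, and the
  sum of the squares of these entries has to be bounded by $n^{1-2e} |z|^2$ for some small $e > 0$.
  The matrix $Y$ with columns $y^k$ is upper triangular and $z 1^T - M Y$ is strictly lower
  triangular. Convolve the rows of $Y$ with the coefficients $c$ of $(1-x)^e$, once causally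
  (giving $X$, still upper triangular) and once anticausally (giving $H$). The symbol $(1-x)^e$ has
  argument $O(e)$ on the unit circle, hence $|X - H| = O(e) |X|$ in the Frobenius norm. On and above
  the diagonal $M H = z q^T$, where the entries of $q$ are partial sums of $c$ and decay like
  $m^{-e}$. Stability of the sections therefore gives $\gamma |X| \le |z| |q| + C |X - H|$, in which
  the last term is absorbed for small $e$, and $|q|^2 = O(n^{1-2e})$. Since $c_0 = 1$, the diagonal
  of $X$ is that of $Y$.

  The last rows of the $M_k^{-1}$ form $L^{-1}$ up to the pivots. The last columns form $U^{-1}$ and
  are the same construction for $M^T$. Finally $L = M U^{-1}$ and $U = L^{-1} M$.
\<close>

section \<open>Euclidean norms of finite families\<close>

lemma L2_set_subset_mono: "finite B \<Longrightarrow> A \<subseteq> B \<Longrightarrow> L2_set f A \<le> L2_set f B"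
  unfolding L2_set_def by (intro real_sqrt_le_mono sum_mono2) auto

lemma L2_set_mono_neutral_left:
  "finite B \<Longrightarrow> A \<subseteq> B \<Longrightarrow> (\<And>i. i \<in> B - A \<Longrightarrow> f i = 0) \<Longrightarrow> L2_set f A = L2_set f B"
  unfolding L2_set_def by (intro arg_cong[where f = sqrt] sum.mono_neutral_left) auto

lemma L2_set_cmult: "L2_set (\<lambda>i. a * f i) I = \<bar>a\<bar> * L2_set f I"
  by (simp add: L2_set_def power_mult_distrib real_sqrt_mult flip: sum_distrib_left)

lemma L2_set_swap:
  "L2_set (\<lambda>j. L2_set (\<lambda>i. f i j) I) J = L2_set (\<lambda>i. L2_set (\<lambda>j. f i j) J) I"
  unfolding L2_set_def by (simp add: sum_nonneg sum.swap[of _ J I])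

lemma L2_set_diagonal_le: "L2_set (\<lambda>j. f j j) A \<le> L2_set (\<lambda>j. L2_set (\<lambda>i. f i j) A) A"
proof (cases "finite A")
  case True
  have "(f j j)\<^sup>2 \<le> (L2_set (\<lambda>i. f i j) A)\<^sup>2" if "j \<in> A" for j
    using True that by (simp add: L2_set_def sum_nonneg member_le_sum[where f = "\<lambda>i. (f i j)\<^sup>2"])
  then show ?thesis
    unfolding L2_set_def[of _ A] by (intro real_sqrt_le_mono sum_mono) (simp add: L2_set_def)
qed simp

lemma L2_set_nat_diff_reindex: "L2_set (\<lambda>j. f (n - Suc j)) {..<n} = L2_set f {..<n}"
  unfolding L2_set_def using sum.nat_diff_reindex[of "\<lambda>j. (f j)\<^sup>2" n] by simp

lemma tendsto_L2_set [tendsto_intros]: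
  assumes "\<And>i. i \<in> A \<Longrightarrow> (f i \<longlongrightarrow> l i) F"
  shows "((\<lambda>x. L2_set (\<lambda>i. f i x) A) \<longlongrightarrow> L2_set l A) F"
  unfolding L2_set_def by (intro tendsto_intros assms)

section \<open>Fractional differences\<close>

definition frac_diff :: "real \<Rightarrow> nat \<Rightarrow> real" where
  "frac_diff e k = (e gchoose k) * (- 1) ^ k"

lemma frac_diff_0 [simp]: "frac_diff e 0 = 1"
  by (simp add: frac_diff_def)

lemma gbinomial_Suc_mult:
  fixes a :: "'a::field_char_0"
  shows "(a gchoose Suc k) = (a gchoose k) * ((a - of_nat k) / of_nat (Suc k))"
  by (simp add: gbinomial_prod_rev prod.atLeast0_lessThan_Suc)

lemma abs_frac_diff_le_one:
  assumes "0 \<le> e" "e \<le> 1"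
  shows "\<bar>frac_diff e k\<bar> \<le> 1"
proof (induction k)
  case (Suc k)
  have "\<bar>frac_diff e (Suc k)\<bar> = \<bar>frac_diff e k\<bar> * (\<bar>e - real k\<bar> / real (Suc k))"
    by (simp add: frac_diff_def gbinomial_Suc_mult abs_mult)
  also have "\<dots> \<le> 1 * 1"
    using Suc assms by (intro mult_mono) (auto simp: divide_le_eq_1)
  finally show ?case by simp
qed simp

lemma sum_frac_diff_Suc:
  "(\<Sum>k\<le>Suc m. frac_diff e k) = (\<Sum>k\<le>m. frac_diff e k) * (1 - e / real (Suc m))"
  unfolding frac_diff_def gbinomial_sum_lower_neg gbinomial_Suc_mult by (simp add: field_simps)

lemma sum_frac_diff_nonneg:
  assumes "0 \<le> e" "e \<le> 1"
  shows "0 \<le> (\<Sum>k\<le>m. frac_diff e k)"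
proof (induction m)
  case (Suc m)
  have "e / real (Suc m) \<le> 1" using assms by simp
  then show ?case unfolding sum_frac_diff_Suc using Suc by (intro mult_nonneg_nonneg) auto
qed simp

lemma Bernoulli_inequality_powr:
  fixes t e :: real
  assumes "0 \<le> e" "e \<le> 1" "t > -1"
  shows "(1 + t) powr e \<le> 1 + e * t"
  using Youngs_inequality_0[of e "1 - e" "1 + t" 1] assms by (simp add: algebra_simps)

lemma sum_frac_diff_le:
  assumes e: "0 \<le> e" "e \<le> 1"
  shows "(\<Sum>k\<le>m. frac_diff e k) \<le> real (Suc m) powr (- e)"
proof (induction m)
  case (Suc m)
  define t where "t = 1 / real (Suc m)"
  have t: "0 < t" "t \<le> 1" by (auto simp: t_def)
  have et: "0 \<le> e * t" "e * t \<le> 1" using t e by (auto intro: mult_le_one)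
  have "(1 - e * t) * (1 + t) powr e \<le> (1 - e * t) * (1 + e * t)"
    using Bernoulli_inequality_powr[of e t] t et e by (intro mult_left_mono) auto
  also have "\<dots> \<le> 1" using zero_le_square[of "e * t"] by (simp add: algebra_simps)
  finally have "1 - e * t \<le> (1 + t) powr (- e)"
    using t by (simp add: powr_minus field_simps)
  then have "(\<Sum>k\<le>m. frac_diff e k) * (1 - e * t) \<le> real (Suc m) powr (- e) * (1 + t) powr (- e)"
    using Suc et by (intro mult_mono) auto
  also have "\<dots> = (real (Suc m) * (1 + t)) powr (- e)"
    using t by (simp add: powr_mult)
  also have "real (Suc m) * (1 + t) = real (Suc (Suc m))"
    by (simp add: t_def field_simps)
  finally show ?case by (simp only: sum_frac_diff_Suc) (simp add: t_def)
qed simp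

lemma powr_neg_le_powr_diff:
  fixes s :: real
  assumes "0 \<le> s" "s < 1"
  shows "(1 - s) * real (Suc n) powr (- s) \<le> real (Suc n) powr (1 - s) - real n powr (1 - s)"
proof (cases "n = 0")
  case False
  define N where "N = real (Suc n)"
  have N: "N > 1" using False by (simp add: N_def)
  have "N * (1 + - 1 / N) = N - 1" using N by (simp add: field_simps)
  then have "real n powr (1 - s) = (N * (1 + - 1 / N)) powr (1 - s)" by (simp add: N_def)
  also have "\<dots> = N powr (1 - s) * (1 + - 1 / N) powr (1 - s)"
    by (rule powr_mult)
  also have "\<dots> \<le> N powr (1 - s) * (1 + (1 - s) * (- 1 / N))"
    using assms N by (intro mult_left_mono Bernoulli_inequality_powr) (auto simp: field_simps)
  also have "\<dots> = N powr (1 - s) - (1 - s) * N powr (- s)"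
    using N by (simp add: powr_diff powr_minus field_simps)
  finally show ?thesis by (simp add: N_def)
qed (use assms in simp)

lemma sum_powr_neg_le:
  fixes s :: real
  assumes s: "0 \<le> s" "s < 1"
  shows "(\<Sum>m<n. real (Suc m) powr (- s)) \<le> real n powr (1 - s) / (1 - s)"
proof -
  have "(1 - s) * (\<Sum>m<n. real (Suc m) powr (- s))
      \<le> (\<Sum>m<n. real (Suc m) powr (1 - s) - real m powr (1 - s))"
    unfolding sum_distrib_left by (intro sum_mono powr_neg_le_powr_diff s)
  also have "\<dots> = real n powr (1 - s)"
    using sum_lessThan_telescope[of "\<lambda>m. real m powr (1 - s)"] by simp
  finally show ?thesis using s by (simp add: field_simps)
qed

lemma L2_set_sum_frac_diff_le:
  assumes "0 \<le> e" "e < 1 / 2"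
  shows "L2_set (\<lambda>m. \<Sum>k\<le>m. frac_diff e k) {..<n}
    \<le> real n powr (1 / 2 - e) / sqrt (1 - 2 * e)"
proof -
  have "(\<Sum>m<n. (\<Sum>k\<le>m. frac_diff e k)\<^sup>2) \<le> (\<Sum>m<n. (real (Suc m) powr (- e))\<^sup>2)"
    using assms by (intro sum_mono power_mono sum_frac_diff_le sum_frac_diff_nonneg) auto
  also have "\<dots> = (\<Sum>m<n. real (Suc m) powr (- (2 * e)))"
    by (simp add: power2_eq_square flip: powr_add)
  also have "\<dots> \<le> real n powr (1 - 2 * e) / (1 - 2 * e)"
    using assms by (intro sum_powr_neg_le) auto
  also have "real n powr (1 - 2 * e) = (real n powr (1 / 2 - e))\<^sup>2"
    by (simp add: power2_eq_square flip: powr_add)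
  finally have "L2_set (\<lambda>m. \<Sum>k\<le>m. frac_diff e k) {..<n}
      \<le> sqrt ((real n powr (1 / 2 - e))\<^sup>2 / (1 - 2 * e))"
    unfolding L2_set_def by (rule real_sqrt_le_mono)
  then show ?thesis by (simp add: real_sqrt_divide)
qed

section \<open>Polynomials with values in a sector\<close>

definition sectorial :: "real \<Rightarrow> complex \<Rightarrow> bool" where
  "sectorial \<eta> z \<longleftrightarrow> \<bar>Im z\<bar> \<le> \<eta> * cmod z"

lemma sectorial_powr:
  assumes "Re z > 0" "0 \<le> e"
  shows "sectorial (2 * e) (z powr of_real e)"
proof -
  have z: "z \<noteq> 0" using assms by auto
  define \<theta> where "\<theta> = e * Im (Ln z)"
  have "\<bar>Im (Ln z)\<bar> < pi / 2" using assms Re_Ln_pos_lt[OF z] by simp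
  then have "\<bar>Im (Ln z)\<bar> \<le> 2" using pi_less_4 by linarith
  then have "\<bar>\<theta>\<bar> \<le> 2 * e"
    using assms mult_left_mono[of "\<bar>Im (Ln z)\<bar>" 2 e] by (simp add: \<theta>_def abs_mult)
  then have "\<bar>sin \<theta>\<bar> \<le> 2 * e" using abs_sin_x_le_abs_x[of \<theta>] by linarith
  then have "exp (e * Re (Ln z)) * \<bar>sin \<theta>\<bar> \<le> exp (e * Re (Ln z)) * (2 * e)"
    by (intro mult_left_mono) auto
  moreover have "z powr of_real e = exp (of_real e * Ln z)" using z by (simp add: powr_def)
  ultimately show ?thesis by (simp add: sectorial_def Im_exp abs_mult \<theta>_def mult_ac)
qed

lemma sectorial_one_minus_powr:
  assumes "cmod u < 1" "0 \<le> e"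
  shows "sectorial (2 * e) ((1 - u) powr of_real e)"
  using complex_Re_le_cmod[of u] assms by (intro sectorial_powr) auto

lemma cmod_one_minus_powr_ge:
  assumes "cmod u < 1" "0 \<le> e"
  shows "(1 - cmod u) powr e \<le> cmod ((1 - u) powr of_real e)"
  using norm_triangle_ineq2[of 1 u] assms by (simp add: norm_powr_real_powr' powr_mono2)

lemma sectorial_perturb:
  assumes z: "sectorial \<eta> z" and \<eta>: "0 \<le> \<eta>"
    and \<tau>: "cmod (z - z') \<le> \<tau>" "(1 + 2 * \<eta>) * \<tau> \<le> \<eta> * cmod z"
  shows "sectorial (2 * \<eta>) z'"
proof -
  have "\<bar>Im z'\<bar> \<le> \<bar>Im z\<bar> + \<tau>" using abs_Im_le_cmod[of "z - z'"] \<tau> by simp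
  also have "\<dots> \<le> \<eta> * cmod z + \<tau>" using z by (simp add: sectorial_def)
  also have "\<dots> \<le> 2 * \<eta> * (cmod z - \<tau>)" using \<tau>(2) by (simp add: algebra_simps)
  also have "\<dots> \<le> 2 * \<eta> * cmod z'"
    using norm_triangle_ineq2[of z z'] \<tau> \<eta> by (intro mult_left_mono) auto
  finally show ?thesis by (simp add: sectorial_def)
qed

abbreviation cpoly :: "real poly \<Rightarrow> complex \<Rightarrow> complex" where
  "cpoly p \<equiv> poly (map_poly complex_of_real p)"

text \<open>The damping factor $\rho < 1$ makes the Taylor series of $(1-\rho z)^e$ converge uniformly
  on the unit circle, where its limit stays away from $0$.\<close>

definition frac_diff_poly :: "real \<Rightarrow> real \<Rightarrow> nat \<Rightarrow> real poly" where
  "frac_diff_poly e \<rho> d = Poly (map (\<lambda>k. frac_diff e k * \<rho> ^ k) [0..<d])"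

lemma coeff_frac_diff_poly:
  "coeff (frac_diff_poly e \<rho> d) k = (if k < d then frac_diff e k * \<rho> ^ k else 0)"
  by (simp add: frac_diff_poly_def nth_default_def)

lemma cpoly_frac_diff_poly:
  "cpoly (frac_diff_poly e \<rho> d) w = (\<Sum>k<d. of_real (frac_diff e k) * (of_real \<rho> * w) ^ k)"
proof -
  have "map_poly complex_of_real (frac_diff_poly e \<rho> d)
      = (\<Sum>k<d. monom (of_real (frac_diff e k * \<rho> ^ k)) k)"
    by (intro poly_eqI) (simp add: coeff_map_poly coeff_frac_diff_poly coeff_sum)
  then show ?thesis by (simp add: poly_sum poly_monom power_mult_distrib mult_ac)
qed

lemma uniform_limit_frac_diff_poly:
  assumes e: "0 \<le> e" "e \<le> 1" and \<rho>: "0 < \<rho>" "\<rho> < 1"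
  shows "uniform_limit (sphere 0 1) (\<lambda>d. cpoly (frac_diff_poly e \<rho> d))
    (\<lambda>w. (1 - of_real \<rho> * w) powr of_real e) sequentially"
proof -
  let ?f = "\<lambda>k w. complex_of_real (frac_diff e k) * (of_real \<rho> * w) ^ k"
  have "(\<Sum>k. ?f k w) = (1 - of_real \<rho> * w) powr of_real e" if "w \<in> sphere 0 1" for w
  proof -
    have "complex_of_real (e gchoose k) = (of_real e gchoose k)" for k
      by (simp add: gbinomial_prod_rev)
    then have "?f k w = (of_real e gchoose k) * (- (of_real \<rho> * w)) ^ k" for k
      by (simp add: frac_diff_def power_minus[of "of_real \<rho> * w"])
    then show ?thesis
      using gen_binomial_complex[of "- (of_real \<rho> * w)" "of_real e"] that \<rho>
      by (simp add: sums_iff norm_mult)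
  qed
  moreover have "uniform_limit (sphere 0 1) (\<lambda>d w. \<Sum>k<d. ?f k w) (\<lambda>w. \<Sum>k. ?f k w) sequentially"
  proof (rule Weierstrass_m_test)
    show "cmod (?f k w) \<le> \<rho> ^ k" if "w \<in> sphere 0 1" for k w
      using abs_frac_diff_le_one[OF e, of k] that \<rho>
      by (simp add: norm_mult norm_power mult_le_cancel_right1)
    show "summable (\<lambda>k. \<rho> ^ k)" using \<rho> by (intro summable_geometric) simp
  qed
  ultimately show ?thesis
    by (subst uniform_limit_cong'[where g = "\<lambda>d w. \<Sum>k<d. ?f k w" and i = "\<lambda>w. \<Sum>k. ?f k w"])
      (simp_all add: cpoly_frac_diff_poly)
qed

lemma eventually_sectorial_frac_diff_poly:
  assumes e: "0 < e" "e \<le> 1" and \<rho>: "0 < \<rho>" "\<rho> < 1"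
  shows "eventually (\<lambda>d. \<forall>w\<in>sphere 0 1. sectorial (4 * e) (cpoly (frac_diff_poly e \<rho> d) w))
    sequentially"
proof -
  define F where "F w = (1 - of_real \<rho> * w) powr complex_of_real e" for w
  define \<tau> where "\<tau> = 2 * e * (1 - \<rho>) powr e / (1 + 4 * e)"
  have "\<tau> > 0" using e \<rho> by (auto simp: \<tau>_def intro!: divide_pos_pos mult_pos_pos)
  then have close: "eventually
      (\<lambda>d. \<forall>w\<in>sphere 0 1. dist (cpoly (frac_diff_poly e \<rho> d) w) (F w) < \<tau>) sequentially"
    using uniform_limitD[OF uniform_limit_frac_diff_poly] e \<rho> by (simp add: F_def)
  have F: "sectorial (2 * e) (F w)" "(1 - \<rho>) powr e \<le> cmod (F w)" if "w \<in> sphere 0 1" for w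
    using sectorial_one_minus_powr[of "of_real \<rho> * w" e]
      cmod_one_minus_powr_ge[of "of_real \<rho> * w" e] that e \<rho>
    by (simp_all add: F_def norm_mult)
  have margin: "(1 + 2 * (2 * e)) * \<tau> \<le> 2 * e * cmod (F w)" if "w \<in> sphere 0 1" for w
  proof -
    have "(1 + 2 * (2 * e)) * \<tau> = 2 * e * (1 - \<rho>) powr e" using e by (simp add: \<tau>_def)
    also have "\<dots> \<le> 2 * e * cmod (F w)" using F(2)[OF that] e by (intro mult_left_mono) auto
    finally show ?thesis .
  qed
  show ?thesis
    using close
  proof (rule eventually_mono, intro ballI)
    fix d and w :: complex
    assume w: "w \<in> sphere 0 1"
      and "\<forall>w\<in>sphere 0 1. dist (cpoly (frac_diff_poly e \<rho> d) w) (F w) < \<tau>"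
    then have "cmod (F w - cpoly (frac_diff_poly e \<rho> d) w) \<le> \<tau>"
      by (simp add: dist_norm norm_minus_commute less_imp_le)
    then have "sectorial (2 * (2 * e)) (cpoly (frac_diff_poly e \<rho> d) w)"
      using sectorial_perturb[OF F(1)[OF w] _ _ margin[OF w]] e by simp
    then show "sectorial (4 * e) (cpoly (frac_diff_poly e \<rho> d) w)" by simp
  qed
qed

lemma ex_damping_L2_set_sum_less:
  fixes a :: "nat \<Rightarrow> real"
  assumes "L2_set (\<lambda>m. \<Sum>k\<le>m. a k) {..<n} < K"
  shows "\<exists>\<rho>. 0 < \<rho> \<and> \<rho> < 1 \<and> L2_set (\<lambda>m. \<Sum>k\<le>m. a k * \<rho> ^ k) {..<n} < K"
proof -
  let ?Q = "\<lambda>\<rho>. L2_set (\<lambda>m. \<Sum>k\<le>m. a k * \<rho> ^ k) {..<n}"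
  have "(?Q \<longlongrightarrow> ?Q 1) (at_left 1)" by (intro tendsto_intros)
  then have "eventually (\<lambda>\<rho>. ?Q \<rho> < K) (at_left 1)"
    using assms by (auto intro: order_tendstoD)
  moreover have "eventually (\<lambda>\<rho>::real. \<rho> \<in> {0<..<1}) (at_left 1)"
    by (rule eventually_at_left_real) simp
  ultimately have "eventually (\<lambda>\<rho>. ?Q \<rho> < K \<and> \<rho> \<in> {0<..<1}) (at_left 1)"
    by (rule eventually_conj)
  then show ?thesis by (auto dest!: eventually_happens)
qed

lemma ex_sectorial_poly:
  assumes e: "0 < e" "e \<le> 1 / 4" and n: "n > 0"
  shows "\<exists>c. coeff c 0 = 1 \<and> L2_set (\<lambda>m. \<Sum>k\<le>m. coeff c k) {..<n} \<le> 2 * real n powr (1 / 2 - e)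
     \<and> (\<forall>w\<in>sphere 0 1. sectorial (4 * e) (cpoly c w))"
proof -
  have "1 / 2 < sqrt (1 - 2 * e)" using e by (intro real_less_rsqrt) (simp add: power2_eq_square)
  then have "1 / sqrt (1 - 2 * e) < 2" using e by (simp add: pos_divide_less_eq)
  then have "real n powr (1 / 2 - e) * (1 / sqrt (1 - 2 * e)) < real n powr (1 / 2 - e) * 2"
    using n by (intro mult_strict_left_mono) auto
  then have "L2_set (\<lambda>m. \<Sum>k\<le>m. frac_diff e k) {..<n} < 2 * real n powr (1 / 2 - e)"
    using L2_set_sum_frac_diff_le[of e n] e by simp
  from ex_damping_L2_set_sum_less[OF this] obtain \<rho> where \<rho>: "0 < \<rho>" "\<rho> < 1"
    and damped: "L2_set (\<lambda>m. \<Sum>k\<le>m. frac_diff e k * \<rho> ^ k) {..<n} < 2 * real n powr (1 / 2 - e)"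
    by blast
  have "eventually
      (\<lambda>d. (\<forall>w\<in>sphere 0 1. sectorial (4 * e) (cpoly (frac_diff_poly e \<rho> d) w)) \<and> n \<le> d)
      sequentially"
    using e \<rho>
    by (intro eventually_conj eventually_sectorial_frac_diff_poly eventually_ge_at_top) auto
  then obtain d where d: "n \<le> d"
    and sect: "\<forall>w\<in>sphere 0 1. sectorial (4 * e) (cpoly (frac_diff_poly e \<rho> d) w)"
    by (auto dest!: eventually_happens)
  have "L2_set (\<lambda>m. \<Sum>k\<le>m. coeff (frac_diff_poly e \<rho> d) k) {..<n}
      = L2_set (\<lambda>m. \<Sum>k\<le>m. frac_diff e k * \<rho> ^ k) {..<n}"
    using d by (intro L2_set_cong refl sum.cong) (auto simp: coeff_frac_diff_poly)
  moreover have "coeff (frac_diff_poly e \<rho> d) 0 = 1" using d n by (simp add: coeff_frac_diff_poly)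
  ultimately show ?thesis
    using damped sect by (intro exI[of _ "frac_diff_poly e \<rho> d"]) simp
qed

section \<open>Causal and anticausal convolution\<close>

lemma sum_roots_unity_power:
  assumes "N > 0"
  shows "(\<Sum>z | z ^ N = 1. z ^ m) = (if N dvd m then complex_of_nat N else 0)"
proof (cases "N dvd m")
  case True
  then have "z ^ m = 1" if "z ^ N = 1" for z :: complex
    using that by (auto simp: power_mult)
  then show ?thesis using True assms by (simp add: card_roots_unity_eq)
next
  case False
  define \<zeta> where "\<zeta> = exp (2 * of_real pi * \<i> / of_nat N)"
  have "\<zeta> ^ m = exp (2 * of_real pi * \<i> * of_nat m / of_nat N)"
    by (simp add: \<zeta>_def mult_ac flip: exp_of_nat_mult)
  then have "\<zeta> ^ m \<noteq> 1" using False assms complex_root_unity_eq_1[of N m] by simp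
  have "\<zeta> ^ N = 1" using complex_root_unity[of N 1] assms by (simp add: \<zeta>_def)
  have "(\<Sum>z | z ^ N = 1. z ^ m) = (\<Sum>z | z ^ N = 1. (\<zeta> * z) ^ m)"
    by (rule sum.reindex_bij_witness[where i = "\<lambda>z. \<zeta> * z" and j = "\<lambda>z. z / \<zeta>"])
      (use \<open>\<zeta> ^ N = 1\<close> in \<open>auto simp: \<zeta>_def power_mult_distrib power_divide\<close>)
  also have "\<dots> = \<zeta> ^ m * (\<Sum>z | z ^ N = 1. z ^ m)"
    by (simp add: power_mult_distrib sum_distrib_left)
  finally have "(\<Sum>z::complex | z ^ N = 1. z ^ m) = 0" using \<open>\<zeta> ^ m \<noteq> 1\<close> by simp
  then show ?thesis using False by simp
qed

lemma sum_roots_unity_orthogonal: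
  assumes "a < N" "b < N"
  shows "(\<Sum>z | z ^ N = 1. z ^ a * cnj z ^ b) = (if a = b then complex_of_nat N else 0)"
proof -
  have "z ^ a * cnj z ^ b = z ^ (a + (N - b))" if "z ^ N = 1" for z :: complex
  proof -
    have "cmod z = 1" using power_eq_1_iff[OF that] assms by simp
    then have "z * cnj z = 1" by (simp flip: complex_norm_square)
    then have "cnj z ^ b * z ^ b = 1" by (simp add: mult.commute flip: power_mult_distrib)
    moreover have "z ^ b * z ^ (N - b) = 1" using that assms by (simp flip: power_add)
    ultimately have "cnj z ^ b = z ^ (N - b)"
      by (metis mult.assoc mult.left_neutral mult.right_neutral)
    then show ?thesis by (simp add: power_add)
  qed
  moreover have "N dvd a + (N - b) \<longleftrightarrow> a = b"
  proof
    assume "N dvd a + (N - b)"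
    then have "int N dvd int a - int b + int N"
      using assms by (simp flip: of_nat_add of_nat_diff add: algebra_simps)
    then have "int N dvd int a - int b" by simp
    then show "a = b" using assms dvd_imp_le_int[of "int a - int b" "int N"] by linarith
  qed (use assms in simp)
  ultimately show ?thesis using assms sum_roots_unity_power[of N "a + (N - b)"] by simp
qed

lemma parseval_roots_unity:
  fixes p :: "complex poly"
  assumes "degree p < N"
  shows "(\<Sum>z | z ^ N = 1. (cmod (poly p z))\<^sup>2) = real N * (\<Sum>k<N. (cmod (coeff p k))\<^sup>2)"
proof -
  have poly_eq: "poly p z = (\<Sum>k<N. coeff p k * z ^ k)" for z
    unfolding poly_altdef
    by (rule sum.mono_neutral_left) (use assms in \<open>auto simp: not_le coeff_eq_0\<close>)
  have "complex_of_real (\<Sum>z | z ^ N = 1. (cmod (poly p z))\<^sup>2)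
      = (\<Sum>z | z ^ N = 1. \<Sum>a<N. \<Sum>b<N. coeff p a * cnj (coeff p b) * (z ^ a * cnj z ^ b))"
    unfolding of_real_sum complex_norm_square poly_eq
    by (simp add: sum_product mult_ac)
  also have "\<dots>
      = (\<Sum>a<N. \<Sum>b<N. coeff p a * cnj (coeff p b) * (\<Sum>z | z ^ N = 1. z ^ a * cnj z ^ b))"
    unfolding sum_distrib_left
    by (rule trans[OF sum.swap]) (intro sum.cong refl sum.swap)
  also have "\<dots> = (\<Sum>a<N. coeff p a * cnj (coeff p a) * of_nat N)"
    by (simp add: sum_roots_unity_orthogonal if_distrib cong: if_cong)
  also have "\<dots> = complex_of_real (real N * (\<Sum>k<N. (cmod (coeff p k))\<^sup>2))"
    unfolding of_real_mult of_real_sum complex_norm_square by (simp add: sum_distrib_left mult_ac)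
  finally show ?thesis by (simp only: of_real_eq_iff)
qed

lemma L2_set_coeff_le_if_cmod_cpoly_le:
  assumes le: "\<And>w. w \<in> sphere 0 1 \<Longrightarrow> cmod (cpoly p w) \<le> B * cmod (cpoly q w)"
    and B: "0 \<le> B" and N: "degree p < N" "degree q < N"
  shows "L2_set (coeff p) {..<N} \<le> B * L2_set (coeff q) {..<N}"
proof -
  have parseval: "(\<Sum>z | z ^ N = 1. (cmod (cpoly r z))\<^sup>2) = real N * (\<Sum>k<N. (coeff r k)\<^sup>2)"
    if "degree r < N" for r
    using parseval_roots_unity[of "map_poly complex_of_real r" N] that
    by (simp add: degree_map_poly coeff_map_poly)
  have "(cmod (cpoly p z))\<^sup>2 \<le> B\<^sup>2 * (cmod (cpoly q z))\<^sup>2" if "z ^ N = 1" for z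
  proof -
    have "cmod z = 1" using power_eq_1_iff[OF that] N by simp
    then have "(cmod (cpoly p z))\<^sup>2 \<le> (B * cmod (cpoly q z))\<^sup>2" by (intro power_mono le) auto
    then show ?thesis by (simp add: power_mult_distrib)
  qed
  then have "(\<Sum>z | z ^ N = 1. (cmod (cpoly p z))\<^sup>2) \<le> B\<^sup>2 * (\<Sum>z | z ^ N = 1. (cmod (cpoly q z))\<^sup>2)"
    unfolding sum_distrib_left by (intro sum_mono) simp
  then have "(\<Sum>k<N. (coeff p k)\<^sup>2) \<le> B\<^sup>2 * (\<Sum>k<N. (coeff q k)\<^sup>2)"
    using N by (simp add: parseval mult.left_commute[of "B\<^sup>2"])
  then have "L2_set (coeff p) {..<N} \<le> sqrt (B\<^sup>2 * (\<Sum>k<N. (coeff q k)\<^sup>2))"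
    unfolding L2_set_def by (rule real_sqrt_le_mono)
  then show ?thesis using B by (simp add: L2_set_def real_sqrt_mult)
qed

definition correlate :: "'a::comm_semiring_0 poly \<Rightarrow> (nat \<Rightarrow> 'a) \<Rightarrow> nat \<Rightarrow> 'a" where
  "correlate c f j = (\<Sum>k\<le>degree c. coeff c k * f (j + k))"

lemma coeff_reflect_poly_mult:
  "coeff (reflect_poly c * y) (j + degree c) = correlate c (coeff y) j"
proof -
  have "coeff (reflect_poly c * y) (j + degree c)
      = (\<Sum>k\<le>degree c. coeff c (degree c - k) * coeff y (j + degree c - k))"
    unfolding coeff_mult by (rule sum.mono_neutral_cong_right) (auto simp: coeff_reflect_poly)
  also have "\<dots> = correlate c (coeff y) j"
    unfolding correlate_def
    by (rule sum.reindex_bij_witness[where i = "\<lambda>k. degree c - k" and j = "\<lambda>k. degree c - k"]) auto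
  finally show ?thesis .
qed

lemma cpoly_mult: "cpoly (p * q) w = cpoly p w * cpoly q w"
proof -
  have "map_poly complex_of_real (p * q) = map_poly of_real p * map_poly of_real q"
    by (intro poly_eqI) (simp add: coeff_map_poly coeff_mult)
  then show ?thesis by simp
qed

lemma cpoly_diff: "cpoly (p - q) w = cpoly p w - cpoly q w"
proof -
  have "map_poly complex_of_real (p - q) = map_poly of_real p - map_poly of_real q"
    by (intro poly_eqI) (simp add: coeff_map_poly)
  then show ?thesis by simp
qed

lemma cpoly_reflect_poly:
  assumes "cmod w = 1"
  shows "cpoly (reflect_poly c) w = w ^ degree c * cnj (cpoly c w)"
proof -
  have "inverse w = cnj w" using assms by (intro inverse_unique) (simp flip: complex_norm_square)
  moreover have "map_poly complex_of_real (reflect_poly c) = reflect_poly (map_poly of_real c)"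
    by (intro poly_eqI) (simp add: coeff_map_poly coeff_reflect_poly degree_map_poly)
  moreover have "cnj (cpoly c w) = cpoly c (cnj w)"
    by (simp add: poly_cnj map_poly_map_poly o_def)
  moreover have "w \<noteq> 0" using assms by auto
  ultimately show ?thesis by (simp add: poly_reflect_poly_nz degree_map_poly)
qed

lemma L2_set_coeff_mult_diff_correlate_le:
  assumes sect: "\<And>w. w \<in> sphere 0 1 \<Longrightarrow> sectorial \<eta> (cpoly c w)" and \<eta>: "0 \<le> \<eta>"
    and N: "degree c + degree y < N"
  shows "L2_set (\<lambda>j. coeff (c * y) j - correlate c (coeff y) j) {..<N}
    \<le> 2 * \<eta> * L2_set (coeff (c * y)) {..<N}"
proof -
  define d where "d = degree c"
  define r where "r = monom 1 d * (c * y) - reflect_poly c * y"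
  have deg: "degree (c * y) < N" using N degree_mult_le[of c y] by linarith
  have "degree (reflect_poly c * y) < N + d"
    using N degree_mult_le[of "reflect_poly c" y] degree_reflect_poly_le[of c] by linarith
  moreover have "degree (monom 1 d * (c * y)) < N + d"
    using deg degree_mult_le[of "monom 1 d" "c * y"] degree_monom_le[of "1::real" d] by linarith
  ultimately have deg_r: "degree r < N + d" unfolding r_def by (intro degree_diff_less)
  have "L2_set (\<lambda>j. coeff (c * y) j - correlate c (coeff y) j) {..<N}
      = L2_set (coeff r) {d..<N + d}"
    unfolding L2_set_def r_def
    by (intro arg_cong[where f = sqrt]
        sum.reindex_bij_witness[where i = "\<lambda>j. j - d" and j = "\<lambda>j. j + d"])
      (auto simp: coeff_monom_mult coeff_reflect_poly_mult d_def)
  also have "\<dots> \<le> L2_set (coeff r) {..<N + d}" by (rule L2_set_subset_mono) auto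
  also have "\<dots> \<le> 2 * \<eta> * L2_set (coeff (c * y)) {..<N + d}"
  proof (rule L2_set_coeff_le_if_cmod_cpoly_le)
    fix w :: complex assume w: "w \<in> sphere 0 1"
    have "cpoly r w = w ^ d * cpoly y w * (cpoly c w - cnj (cpoly c w))"
      using w by (simp add: r_def cpoly_diff cpoly_mult cpoly_reflect_poly map_poly_monom poly_monom
          d_def algebra_simps)
    then have "cmod (cpoly r w) = cmod (cpoly y w) * (2 * \<bar>Im (cpoly c w)\<bar>)"
      using w by (simp add: complex_diff_cnj norm_mult norm_power)
    also have "\<dots> \<le> cmod (cpoly y w) * (2 * (\<eta> * cmod (cpoly c w)))"
      using sect[OF w] by (intro mult_left_mono) (auto simp: sectorial_def)
    finally show "cmod (cpoly r w) \<le> 2 * \<eta> * cmod (cpoly (c * y) w)"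
      by (simp add: cpoly_mult norm_mult mult_ac)
  qed (use \<eta> deg deg_r in auto)
  also have "L2_set (coeff (c * y)) {..<N + d} = L2_set (coeff (c * y)) {..<N}"
    using deg by (intro L2_set_mono_neutral_left[symmetric]) (auto simp: coeff_eq_0)
  finally show ?thesis .
qed

lemma correlate_cmult_cong:
  assumes "\<And>k. j \<le> k \<Longrightarrow> f k = a * g k"
  shows "correlate c f j = a * correlate c g j"
  using assms by (simp add: correlate_def sum_distrib_left mult_ac)

lemma sum_mult_correlate:
  "(\<Sum>i\<in>I. a i * correlate c (f i) j) = correlate c (\<lambda>k. \<Sum>i\<in>I. a i * f i k) j"
  unfolding correlate_def sum_distrib_left
  by (subst sum.swap) (intro sum.cong refl, simp add: mult_ac)

lemma correlate_initial_segment: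
  fixes c :: "'a::comm_semiring_1 poly"
  shows "correlate c (\<lambda>k. if k < n then 1 else 0) j
    = (if j < n then \<Sum>k\<le>n - Suc j. coeff c k else 0)"
proof -
  have "correlate c (\<lambda>k. if k < n then 1 else 0) j = (\<Sum>k | k \<le> degree c \<and> j + k < n. coeff c k)"
    unfolding correlate_def by (rule sum.mono_neutral_cong_right) auto
  also have "\<dots> = (\<Sum>k\<in>{k. j + k < n}. coeff c k)"
    by (rule sum.mono_neutral_left)
      (auto simp: le_degree intro: finite_subset[of _ "{..<n}"])
  also have "{k. j + k < n} = (if j < n then {..n - Suc j} else {})" by auto
  finally show ?thesis by simp
qed

lemma L2_set_correlate_initial_segment:
  assumes "n \<le> N"
  shows "L2_set (correlate c (\<lambda>k. if k < n then 1 else 0)) {..<N}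
    = L2_set (\<lambda>m. \<Sum>k\<le>m. coeff c k) {..<n}"
proof -
  have "L2_set (correlate c (\<lambda>k. if k < n then 1 else 0)) {..<N}
      = L2_set (correlate c (\<lambda>k. if k < n then 1 else 0)) {..<n}"
    using assms
    by (intro L2_set_mono_neutral_left[symmetric]) (auto simp: correlate_initial_segment)
  also have "\<dots> = L2_set (\<lambda>j. \<Sum>k\<le>n - Suc j. coeff c k) {..<n}"
    by (intro L2_set_cong refl) (simp add: correlate_initial_segment)
  also have "\<dots> = L2_set (\<lambda>m. \<Sum>k\<le>m. coeff c k) {..<n}"
    by (rule L2_set_nat_diff_reindex)
  finally show ?thesis .
qed

lemma coeff_mult_eq_if_coeff_eq_0_below:
  assumes "\<And>k. k < j \<Longrightarrow> coeff y k = 0"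
  shows "coeff (c * y) j = coeff c 0 * coeff y j"
proof -
  have "coeff (c * y) j = (\<Sum>k\<in>{0}. coeff c k * coeff y (j - k))"
    unfolding coeff_mult by (rule sum.mono_neutral_right) (use assms in auto)
  then show ?thesis by simp
qed

section \<open>Galerkin solutions\<close>

locale stable_sections =
  fixes A :: "nat \<Rightarrow> nat \<Rightarrow> real" and n :: nat and C \<gamma> :: real
  assumes C_pos: "0 < C" and \<gamma>_pos: "0 < \<gamma>"
    and bounded: "L2_set (\<lambda>l. \<Sum>i<n. A l i * x i) {..<n} \<le> C * L2_set x {..<n}"
    and stable: "k \<le> n \<Longrightarrow> \<gamma> * L2_set x {..<k} \<le> L2_set (\<lambda>l. \<Sum>i<k. A l i * x i) {..<k}"
begin

lemma L2_set_le_if_section_residual: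
  assumes k: "k \<le> n" and x: "\<And>i. k \<le> i \<Longrightarrow> i < n \<Longrightarrow> x i = 0"
    and h: "\<And>l. l < k \<Longrightarrow> (\<Sum>i<n. A l i * h i) = a * z l"
  shows "\<gamma> * L2_set x {..<n} \<le> \<bar>a\<bar> * L2_set z {..<n} + C * L2_set (\<lambda>i. x i - h i) {..<n}"
proof -
  have "\<gamma> * L2_set x {..<n} = \<gamma> * L2_set x {..<k}"
    using k x by (intro arg_cong2[where f = "(*)"] refl L2_set_mono_neutral_left[symmetric]) auto
  also have "\<dots> \<le> L2_set (\<lambda>l. \<Sum>i<k. A l i * x i) {..<k}" by (rule stable[OF k])
  also have "\<dots> = L2_set (\<lambda>l. a * z l + (\<Sum>i<n. A l i * (x i - h i))) {..<k}"
  proof (intro L2_set_cong refl)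
    fix l assume "l \<in> {..<k}"
    then have "a * z l + (\<Sum>i<n. A l i * (x i - h i)) = (\<Sum>i<n. A l i * x i)"
      by (simp add: right_diff_distrib sum_subtractf h)
    also have "\<dots> = (\<Sum>i<k. A l i * x i)"
      using k x by (intro sum.mono_neutral_right) auto
    finally show "(\<Sum>i<k. A l i * x i) = a * z l + (\<Sum>i<n. A l i * (x i - h i))" ..
  qed
  also have "\<dots> \<le> L2_set (\<lambda>l. a * z l + (\<Sum>i<n. A l i * (x i - h i))) {..<n}"
    using k by (intro L2_set_subset_mono) auto
  also have "\<dots> \<le> L2_set (\<lambda>l. a * z l) {..<n} + L2_set (\<lambda>l. \<Sum>i<n. A l i * (x i - h i)) {..<n}"
    by (rule L2_set_triangle_ineq)
  also have "L2_set (\<lambda>l. a * z l) {..<n} = \<bar>a\<bar> * L2_set z {..<n}"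
    by (rule L2_set_cmult)
  also have "L2_set (\<lambda>l. \<Sum>i<n. A l i * (x i - h i)) {..<n} \<le> C * L2_set (\<lambda>i. x i - h i) {..<n}"
    by (rule bounded)
  finally show ?thesis by simp
qed

lemma L2_set_columns_le_if_section_residual:
  assumes X: "\<And>i j. j < i \<Longrightarrow> X i j = 0"
    and H: "\<And>l j. l \<le> j \<Longrightarrow> l < n \<Longrightarrow> (\<Sum>i<n. A l i * H i j) = q j * z l"
  shows "\<gamma> * L2_set (\<lambda>j. L2_set (\<lambda>i. X i j) {..<n}) J
    \<le> L2_set q J * L2_set z {..<n} + C * L2_set (\<lambda>j. L2_set (\<lambda>i. X i j - H i j) {..<n}) J"
proof -
  have "\<gamma> * L2_set (\<lambda>i. X i j) {..<n}
      \<le> \<bar>q j\<bar> * L2_set z {..<n} + C * L2_set (\<lambda>i. X i j - H i j) {..<n}" for j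
    by (rule L2_set_le_if_section_residual[where k = "min (Suc j) n"])
      (use X H in \<open>auto simp: min_def not_le split: if_splits\<close>)
  then have "L2_set (\<lambda>j. \<gamma> * L2_set (\<lambda>i. X i j) {..<n}) J
      \<le> L2_set (\<lambda>j. \<bar>q j\<bar> * L2_set z {..<n} + C * L2_set (\<lambda>i. X i j - H i j) {..<n}) J"
    using \<gamma>_pos by (intro L2_set_mono) auto
  also have "\<dots> \<le> L2_set (\<lambda>j. \<bar>q j\<bar> * L2_set z {..<n}) J
      + L2_set (\<lambda>j. C * L2_set (\<lambda>i. X i j - H i j) {..<n}) J"
    by (rule L2_set_triangle_ineq)
  also have "L2_set (\<lambda>j. \<bar>q j\<bar> * L2_set z {..<n}) J = L2_set q J * L2_set z {..<n}"
    by (subst L2_set_left_distrib[symmetric]) (simp_all add: L2_set_def sum_nonneg)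
  finally show ?thesis
    using C_pos \<gamma>_pos by (simp add: L2_set_right_distrib)
qed

lemma L2_set_convolution_le:
  fixes y :: "nat \<Rightarrow> real poly" and u z :: "nat \<Rightarrow> real"
  assumes sect: "\<And>w. w \<in> sphere 0 1 \<Longrightarrow> sectorial \<eta> (cpoly c w)"
    and \<eta>: "0 \<le> \<eta>" "4 * C * \<eta> \<le> \<gamma>"
    and deg: "\<And>i. degree c + degree (y i) < N"
    and upper: "\<And>i k. k < i \<Longrightarrow> coeff (y i) k = 0"
    and galerkin: "\<And>l k. l \<le> k \<Longrightarrow> (\<Sum>i<n. A l i * coeff (y i) k) = z l * u k"
  shows "\<gamma> * L2_set (\<lambda>j. L2_set (\<lambda>i. coeff (c * y i) j) {..<n}) {..<N}
    \<le> 2 * L2_set (correlate c u) {..<N} * L2_set z {..<n}" (is "\<gamma> * ?X \<le> 2 * ?q * ?z")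
proof -
  define X where "X i j = coeff (c * y i) j" for i j
  define H where "H i j = correlate c (coeff (y i)) j" for i j
  have X_upper: "X i j = 0" if "j < i" for i j
    unfolding X_def using that upper by (simp add: coeff_mult_eq_if_coeff_eq_0_below)
  have residual: "(\<Sum>i<n. A l i * H i j) = correlate c u j * z l" if "l \<le> j" for l j
    unfolding H_def sum_mult_correlate mult.commute[of _ "z l"]
    using that galerkin by (intro correlate_cmult_cong) auto
  have "L2_set (\<lambda>j. L2_set (\<lambda>i. X i j - H i j) {..<n}) {..<N}
      = L2_set (\<lambda>i. L2_set (\<lambda>j. X i j - H i j) {..<N}) {..<n}"
    by (rule L2_set_swap)
  also have "\<dots> \<le> L2_set (\<lambda>i. 2 * \<eta> * L2_set (\<lambda>j. X i j) {..<N}) {..<n}"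
    unfolding X_def H_def
    using \<eta> sect deg by (intro L2_set_mono L2_set_coeff_mult_diff_correlate_le) auto
  also have "\<dots> = 2 * \<eta> * ?X"
    using \<eta> by (simp add: L2_set_cmult L2_set_swap[of _ "{..<n}"] X_def)
  finally have close: "L2_set (\<lambda>j. L2_set (\<lambda>i. X i j - H i j) {..<n}) {..<N} \<le> 2 * \<eta> * ?X" .
  have "\<gamma> * ?X \<le> ?q * ?z + C * L2_set (\<lambda>j. L2_set (\<lambda>i. X i j - H i j) {..<n}) {..<N}"
    using L2_set_columns_le_if_section_residual[of X H "correlate c u" z "{..<N}"] X_upper residual
    by (simp add: X_def)
  also have "\<dots> \<le> ?q * ?z + C * (2 * \<eta> * ?X)"
    using close C_pos by (intro add_left_mono mult_left_mono) auto
  also have "C * (2 * \<eta> * ?X) = 4 * C * \<eta> * ?X / 2" by simp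
  also have "\<dots> \<le> \<gamma> * ?X / 2" using \<eta> by (intro divide_right_mono mult_right_mono) auto
  finally show ?thesis by simp
qed

theorem L2_set_galerkin_diagonal_le:
  fixes Y :: "nat \<Rightarrow> nat \<Rightarrow> real" and z :: "nat \<Rightarrow> real"
  assumes e: "0 < e" "e \<le> 1 / 4" "16 * C * e \<le> \<gamma>"
    and upper: "\<And>i k. k < i \<Longrightarrow> Y i k = 0"
    and galerkin: "\<And>l k. l \<le> k \<Longrightarrow> k < n \<Longrightarrow> (\<Sum>i<n. A l i * Y i k) = z l"
  shows "L2_set (\<lambda>k. Y k k) {..<n} \<le> 4 / \<gamma> * real n powr (1 / 2 - e) * L2_set z {..<n}"
proof (cases "n = 0")
  case False
  then obtain c where c0: "coeff c 0 = 1"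
    and c_sums: "L2_set (\<lambda>m. \<Sum>k\<le>m. coeff c k) {..<n} \<le> 2 * real n powr (1 / 2 - e)"
    and c_sect: "\<And>w. w \<in> sphere 0 1 \<Longrightarrow> sectorial (4 * e) (cpoly c w)"
    using ex_sectorial_poly[of e n] e by blast
  define N where "N = n + degree c"
  define y where "y i = Poly (map (Y i) [0..<n])" for i
  define u where "u k = (if k < n then 1 else 0 :: real)" for k
  have y: "coeff (y i) k = (if k < n then Y i k else 0)" for i k
    by (simp add: y_def nth_default_def)
  have deg: "degree c + degree (y i) < N" for i
    using False by (auto simp: N_def y intro!: degree_lessI)
  have diag: "coeff (c * y k) k = Y k k" if "k < n" for k
    using that upper c0 by (simp add: coeff_mult_eq_if_coeff_eq_0_below y)
  have "L2_set (\<lambda>k. Y k k) {..<n} = L2_set (\<lambda>k. coeff (c * y k) k) {..<n}"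
    by (simp add: diag cong: L2_set_cong_simp)
  also have "\<dots> \<le> L2_set (\<lambda>j. L2_set (\<lambda>i. coeff (c * y i) j) {..<n}) {..<n}"
    by (rule L2_set_diagonal_le)
  also have "\<dots> \<le> L2_set (\<lambda>j. L2_set (\<lambda>i. coeff (c * y i) j) {..<n}) {..<N}"
    by (rule L2_set_subset_mono) (auto simp: N_def)
  finally have "\<gamma> * L2_set (\<lambda>k. Y k k) {..<n}
      \<le> \<gamma> * L2_set (\<lambda>j. L2_set (\<lambda>i. coeff (c * y i) j) {..<n}) {..<N}"
    using \<gamma>_pos by (intro mult_left_mono) auto
  also have "\<dots> \<le> 2 * L2_set (correlate c u) {..<N} * L2_set z {..<n}"
    using e upper galerkin
    by (intro L2_set_convolution_le[where \<eta> = "4 * e"] c_sect deg) (auto simp: y u_def)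
  also have "L2_set (correlate c u) {..<N} = L2_set (\<lambda>m. \<Sum>k\<le>m. coeff c k) {..<n}"
    unfolding u_def N_def by (rule L2_set_correlate_initial_segment) simp
  also have "2 * \<dots> * L2_set z {..<n} \<le> 2 * (2 * real n powr (1 / 2 - e)) * L2_set z {..<n}"
    using c_sums by (intro mult_left_mono mult_right_mono) auto
  finally show ?thesis using \<gamma>_pos by (simp add: field_simps)
qed simp

lemma L2_set_column_le:
  assumes "k < n"
  shows "L2_set (\<lambda>l. A l k) {..<n} \<le> C"
proof -
  define u where "u i = (if i = k then 1 else 0 :: real)" for i
  have "L2_set u {..<n} = 1"
    using assms L2_set_mono_neutral_left[of "{..<n}" "{k}" u] by (simp add: u_def)
  then show ?thesis using bounded[of u] assms by (simp add: u_def if_distrib cong: if_cong)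
qed

lemma L2_set_below_last_entry_le:
  assumes k: "k < n" and x: "\<And>l. l < k \<Longrightarrow> (\<Sum>i<Suc k. A l i * x i) = 0"
  shows "L2_set x {..<k} \<le> C / \<gamma> * \<bar>x k\<bar>"
proof -
  have "\<gamma> * L2_set x {..<k} \<le> L2_set (\<lambda>l. \<Sum>i<k. A l i * x i) {..<k}"
    using k by (intro stable) simp
  also have "\<dots> = L2_set (\<lambda>l. - x k * A l k) {..<k}"
    using x by (intro L2_set_cong refl) (simp add: add_eq_0_iff mult.commute)
  also have "\<dots> \<le> \<bar>x k\<bar> * L2_set (\<lambda>l. A l k) {..<n}"
    unfolding L2_set_cmult abs_minus using k by (intro mult_left_mono L2_set_subset_mono) auto
  also have "\<dots> \<le> \<bar>x k\<bar> * C"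
    by (intro mult_left_mono L2_set_column_le k) simp
  finally show ?thesis using \<gamma>_pos by (simp add: field_simps)
qed

lemma last_entry_lower_bound:
  assumes k: "k < n" and x: "\<And>i. k < i \<Longrightarrow> x i = 0"
    and solves: "\<And>l. l \<le> k \<Longrightarrow> (\<Sum>i<n. A l i * x i) = (if l = k then 1 else 0)"
  shows "1 \<le> C * (1 + C / \<gamma>) * \<bar>x k\<bar>"
proof -
  have "(\<Sum>i<n. A l i * x i) = (\<Sum>i<Suc k. A l i * x i)" for l
    by (rule sum.mono_neutral_right) (use k x in auto)
  then have "L2_set x {..<k} \<le> C / \<gamma> * \<bar>x k\<bar>"
    using solves by (intro L2_set_below_last_entry_le k) (metis less_imp_le less_irrefl)
  have "1 = (\<Sum>i<n. A k i * x i)" using solves[of k] by simp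
  also have "\<dots> \<le> L2_set (\<lambda>l. \<Sum>i<n. A l i * x i) {..<n}"
    using k by (intro member_le_L2_set[where f = "\<lambda>l. \<Sum>i<n. A l i * x i"]) auto
  also have "\<dots> \<le> C * L2_set x {..<n}" by (rule bounded)
  also have "L2_set x {..<n} = L2_set x (insert k {..<k})"
    using k x by (intro L2_set_mono_neutral_left[symmetric]) auto
  also have "\<dots> \<le> \<bar>x k\<bar> + L2_set x {..<k}"
    using sqrt_sum_squares_le_sum_abs[of "x k" "L2_set x {..<k}"] by simp
  also have "\<dots> \<le> \<bar>x k\<bar> + C / \<gamma> * \<bar>x k\<bar>" by (rule add_left_mono) fact
  finally show ?thesis using C_pos by (simp add: algebra_simps mult_left_mono)
qed

end

section \<open>The spectral norm\<close>

lemma vec_l2_eq_L2_set: "vec_l2 v = L2_set (vec_index v) {..<dim_vec v}"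
  by (simp add: vec_l2_def L2_set_def)

lemma vec_l2_nonneg: "0 \<le> vec_l2 v"
  by (simp add: vec_l2_eq_L2_set)

lemma vec_l2_smult: "vec_l2 (a \<cdot>\<^sub>v v) = \<bar>a\<bar> * vec_l2 v"
  by (simp add: vec_l2_eq_L2_set L2_set_cmult[symmetric] cong: L2_set_cong_simp)

lemma vec_l2_eq_0_iff: "v \<in> carrier_vec n \<Longrightarrow> vec_l2 v = 0 \<longleftrightarrow> v = 0\<^sub>v n"
  by (auto simp: vec_l2_eq_L2_set L2_set_eq_0_iff)

lemma power2_vec_l2: "(vec_l2 v)\<^sup>2 = v \<bullet> v"
  by (simp add: vec_l2_def sum_nonneg scalar_prod_def atLeast0LessThan power2_eq_square)

lemma abs_scalar_prod_le_vec_l2: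
  assumes "v \<in> carrier_vec n" "w \<in> carrier_vec n"
  shows "\<bar>v \<bullet> w\<bar> \<le> vec_l2 v * vec_l2 w"
proof -
  have "\<bar>v \<bullet> w\<bar> \<le> (\<Sum>i<n. \<bar>vec_index v i\<bar> * \<bar>vec_index w i\<bar>)"
    using assms sum_abs[of "\<lambda>i. vec_index v i * vec_index w i" "{..<n}"]
    by (simp add: scalar_prod_def atLeast0LessThan abs_mult)
  also have "\<dots> \<le> vec_l2 v * vec_l2 w"
    using assms L2_set_mult_ineq[of "vec_index v" "vec_index w"] by (simp add: vec_l2_eq_L2_set)
  finally show ?thesis .
qed

lemma index_mult_mat_vec_sum:
  assumes "A \<in> carrier_mat n m" "v \<in> carrier_vec m" "i < n"
  shows "vec_index (A *\<^sub>v v) i = (\<Sum>j<m. A $$ (i,j) * vec_index v j)"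
  using assms by (simp add: scalar_prod_def atLeast0LessThan)

lemma index_mult_mat_sum:
  assumes "A \<in> carrier_mat n m" "B \<in> carrier_mat m k" "i < n" "j < k"
  shows "(A * B) $$ (i,j) = (\<Sum>l<m. A $$ (i,l) * B $$ (l,j))"
  using assms by (simp add: scalar_prod_def atLeast0LessThan)

lemma vec_l2_mult_mat_vec:
  assumes "A \<in> carrier_mat n m"
  shows "vec_l2 (A *\<^sub>v Matrix.vec m x) = L2_set (\<lambda>i. \<Sum>j<m. A $$ (i,j) * x j) {..<n}"
  using assms by (simp add: vec_l2_eq_L2_set index_mult_mat_vec_sum[of A n m] cong: L2_set_cong_simp
    del: index_mult_mat_vec)

lemma vec_l2_mult_mat_vec_le_rows:
  assumes A: "A \<in> carrier_mat n m" and v: "v \<in> carrier_vec m"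
  shows "vec_l2 (A *\<^sub>v v) \<le> L2_set (\<lambda>i. vec_l2 (Matrix.row A i)) {..<n} * vec_l2 v"
proof -
  have "vec_l2 (A *\<^sub>v v) = L2_set (\<lambda>i. \<bar>Matrix.row A i \<bullet> v\<bar>) {..<n}"
    using A by (simp add: vec_l2_eq_L2_set L2_set_def)
  also have "\<dots> \<le> L2_set (\<lambda>i. vec_l2 (Matrix.row A i) * vec_l2 v) {..<n}"
    using A v by (intro L2_set_mono abs_scalar_prod_le_vec_l2) auto
  also have "\<dots> = L2_set (\<lambda>i. vec_l2 (Matrix.row A i)) {..<n} * vec_l2 v"
    by (simp add: L2_set_left_distrib vec_l2_nonneg)
  finally show ?thesis .
qed

lemma spec_norm_upper:
  assumes A: "A \<in> carrier_mat n m" and v: "v \<in> carrier_vec m" "vec_l2 v \<le> 1"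
  shows "vec_l2 (A *\<^sub>v v) \<le> spec_norm A"
  unfolding spec_norm_def
proof (rule cSup_upper)
  let ?S = "{vec_l2 (A *\<^sub>v u) | u. u \<in> carrier_vec (dim_col A) \<and> vec_l2 u \<le> 1}"
  let ?R = "L2_set (\<lambda>i. vec_l2 (Matrix.row A i)) {..<n}"
  show "vec_l2 (A *\<^sub>v v) \<in> ?S" using A v by auto
  have "vec_l2 (A *\<^sub>v u) \<le> ?R" if "u \<in> carrier_vec m" "vec_l2 u \<le> 1" for u
    using vec_l2_mult_mat_vec_le_rows[OF A that(1)] mult_left_le[OF that(2), of ?R] by simp
  then show "bdd_above ?S" using A by (intro bdd_aboveI[of _ ?R]) auto
qed

lemma spec_norm_nonneg: "0 \<le> spec_norm A"
  using spec_norm_upper[of A "dim_row A" "dim_col A" "0\<^sub>v (dim_col A)"]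
    vec_l2_nonneg[of "A *\<^sub>v 0\<^sub>v (dim_col A)"]
    vec_l2_eq_0_iff[of "0\<^sub>v (dim_col A)" "dim_col A"]
  by simp

lemma vec_l2_mult_mat_vec_le:
  assumes A: "A \<in> carrier_mat n m" and v: "v \<in> carrier_vec m"
  shows "vec_l2 (A *\<^sub>v v) \<le> spec_norm A * vec_l2 v"
proof (cases "vec_l2 v = 0")
  case True
  then have "A *\<^sub>v v = 0\<^sub>v n"
    using A v by (auto simp: vec_l2_eq_0_iff scalar_prod_def)
  then show ?thesis using True vec_l2_eq_0_iff[of "0\<^sub>v n" n] by simp
next
  case False
  then have pos: "vec_l2 v > 0" using vec_l2_nonneg[of v] by linarith
  define u where "u = (1 / vec_l2 v) \<cdot>\<^sub>v v"
  have "u \<in> carrier_vec m" "vec_l2 u \<le> 1" using v pos by (auto simp: u_def vec_l2_smult)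
  then have "vec_l2 (A *\<^sub>v u) \<le> spec_norm A" by (rule spec_norm_upper[OF A])
  moreover have "A *\<^sub>v u = (1 / vec_l2 v) \<cdot>\<^sub>v (A *\<^sub>v v)"
    unfolding u_def using A v by (rule mult_mat_vec)
  ultimately show ?thesis using pos by (simp add: vec_l2_smult field_simps)
qed

lemma spec_norm_least:
  assumes A: "A \<in> carrier_mat n m" and b: "b \<ge> 0"
    and le: "\<And>v. v \<in> carrier_vec m \<Longrightarrow> vec_l2 (A *\<^sub>v v) \<le> b * vec_l2 v"
  shows "spec_norm A \<le> b"
  unfolding spec_norm_def
proof (rule cSup_least)
  have "vec_l2 (0\<^sub>v m) = 0" using vec_l2_eq_0_iff[of "0\<^sub>v m" m] by simp
  then show "{vec_l2 (A *\<^sub>v v) | v. v \<in> carrier_vec (dim_col A) \<and> vec_l2 v \<le> 1} \<noteq> {}"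
    using A by (auto intro!: exI[of _ "0\<^sub>v m"])
next
  fix x assume "x \<in> {vec_l2 (A *\<^sub>v v) | v. v \<in> carrier_vec (dim_col A) \<and> vec_l2 v \<le> 1}"
  then obtain v where v: "v \<in> carrier_vec m" "vec_l2 v \<le> 1" "x = vec_l2 (A *\<^sub>v v)" using A by auto
  then have "x \<le> b * vec_l2 v" using le by simp
  also have "\<dots> \<le> b" using v b by (intro mult_left_le)
  finally show "x \<le> b" .
qed

lemma spec_norm_mult_le:
  assumes A: "A \<in> carrier_mat n m" and B: "B \<in> carrier_mat m k"
  shows "spec_norm (A * B) \<le> spec_norm A * spec_norm B"
proof (rule spec_norm_least)
  show "A * B \<in> carrier_mat n k" using A B by simp
  fix v :: "real Matrix.vec" assume v: "v \<in> carrier_vec k"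
  have "vec_l2 (A * B *\<^sub>v v) = vec_l2 (A *\<^sub>v (B *\<^sub>v v))" using A B v by simp
  also have "\<dots> \<le> spec_norm A * vec_l2 (B *\<^sub>v v)"
    using A B v by (intro vec_l2_mult_mat_vec_le) auto
  also have "\<dots> \<le> spec_norm A * (spec_norm B * vec_l2 v)"
    by (intro mult_left_mono vec_l2_mult_mat_vec_le[OF B v] spec_norm_nonneg)
  finally show "vec_l2 (A * B *\<^sub>v v) \<le> spec_norm A * spec_norm B * vec_l2 v"
    by (simp add: mult.assoc)
qed (simp add: spec_norm_nonneg)

lemma spec_norm_transpose_le:
  assumes A: "A \<in> carrier_mat n m"
  shows "spec_norm (transpose_mat A) \<le> spec_norm A"
proof (rule spec_norm_least)
  show "transpose_mat A \<in> carrier_mat m n" using A by simp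
  fix v :: "real Matrix.vec" assume v: "v \<in> carrier_vec n"
  define w where "w = transpose_mat A *\<^sub>v v"
  have w: "w \<in> carrier_vec m" using A v by (simp add: w_def)
  have "vec_l2 w * vec_l2 w = w \<bullet> w" by (simp flip: power2_vec_l2 add: power2_eq_square)
  also have "\<dots> = v \<bullet> (A *\<^sub>v w)"
    using transpose_vec_mult_scalar[OF A w v] by (simp add: w_def)
  also have "\<dots> \<le> vec_l2 v * vec_l2 (A *\<^sub>v w)"
    using abs_scalar_prod_le_vec_l2[of v n "A *\<^sub>v w"] A v w by simp
  also have "\<dots> \<le> vec_l2 v * (spec_norm A * vec_l2 w)"
    by (intro mult_left_mono vec_l2_mult_mat_vec_le[OF A w] vec_l2_nonneg)
  finally have "vec_l2 w * vec_l2 w \<le> (spec_norm A * vec_l2 v) * vec_l2 w" by (simp add: mult_ac)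
  then show "vec_l2 w \<le> spec_norm A * vec_l2 v"
    using vec_l2_nonneg[of w] vec_l2_nonneg[of v] spec_norm_nonneg[of A]
    by (cases "vec_l2 w = 0") (auto simp: mult_le_cancel_right)
qed (rule spec_norm_nonneg)

lemma spec_norm_transpose: "spec_norm (transpose_mat A) = spec_norm A"
  using spec_norm_transpose_le[of A "dim_row A" "dim_col A"]
    spec_norm_transpose_le[of "transpose_mat A" "dim_col A" "dim_row A"] by simp

lemma spec_norm_mat_diag_le:
  assumes f: "\<And>i. i < n \<Longrightarrow> \<bar>f i\<bar> \<le> K" and K: "0 \<le> K"
  shows "spec_norm (mat_diag n f) \<le> K"
proof (rule spec_norm_least[OF mat_diag_dim K])
  fix v :: "real Matrix.vec" assume v: "v \<in> carrier_vec n"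
  have "vec_index (mat_diag n f *\<^sub>v v) i = f i * vec_index v i" if "i < n" for i
  proof -
    have "vec_index (mat_diag n f *\<^sub>v v) i = (\<Sum>j<n. if i = j then f j * vec_index v j else 0)"
      unfolding index_mult_mat_vec_sum[OF mat_diag_dim v that]
      using that by (intro sum.cong) (auto simp: mat_diag_def)
    then show ?thesis using that by simp
  qed
  then have "vec_l2 (mat_diag n f *\<^sub>v v) = L2_set (\<lambda>i. \<bar>f i * vec_index v i\<bar>) {..<n}"
    using carrier_matD(1)[OF mat_diag_dim[of n f]]
    by (simp add: vec_l2_eq_L2_set L2_set_def del: index_mult_mat_vec)
  also have "\<dots> \<le> L2_set (\<lambda>i. K * \<bar>vec_index v i\<bar>) {..<n}"
    using f by (intro L2_set_mono) (auto simp: abs_mult mult_right_mono)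
  also have "\<dots> = K * vec_l2 v"
    using K v by (simp add: L2_set_cmult vec_l2_eq_L2_set) (simp add: L2_set_def)
  finally show "vec_l2 (mat_diag n f *\<^sub>v v) \<le> K * vec_l2 v" .
qed

lemma vec_l2_le_left_inverse:
  assumes "B \<in> carrier_mat n m" "A \<in> carrier_mat m n" "B * A = 1\<^sub>m n" "v \<in> carrier_vec n"
  shows "vec_l2 v \<le> spec_norm B * vec_l2 (A *\<^sub>v v)"
proof -
  have "B *\<^sub>v (A *\<^sub>v v) = v" using assms by (simp flip: assoc_mult_mat_vec)
  then show ?thesis using vec_l2_mult_mat_vec_le[of B n m "A *\<^sub>v v"] assms by simp
qed

section \<open>The triangular factors\<close>

lemma ul_sub_carrier: "ul_sub A k \<in> carrier_mat k k"
  by (simp add: ul_sub_def)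

lemma ul_sub_transpose:
  "A \<in> carrier_mat n m \<Longrightarrow> k \<le> n \<Longrightarrow> k \<le> m \<Longrightarrow>
    ul_sub (transpose_mat A) k = transpose_mat (ul_sub A k)"
  by (intro eq_matI) (auto simp: ul_sub_def)

lemma is_inverse_of_iff:
  assumes "A \<in> carrier_mat n n"
  shows "is_inverse_of B A \<longleftrightarrow> B \<in> carrier_mat n n \<and> A * B = 1\<^sub>m n \<and> B * A = 1\<^sub>m n"
  using assms by (auto simp: is_inverse_of_def inverts_mat_def)

lemma is_inverse_of_transpose:
  assumes A: "A \<in> carrier_mat n n" and "is_inverse_of B A"
  shows "is_inverse_of (transpose_mat B) (transpose_mat A)"
proof -
  have "B \<in> carrier_mat n n" "A * B = 1\<^sub>m n" "B * A = 1\<^sub>m n"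
    using assms by (auto simp: is_inverse_of_iff)
  then show ?thesis
    using A by (auto simp: is_inverse_of_iff[of _ n] simp flip: transpose_mult)
qed

lemma index_mult_upper_triangular:
  fixes A B :: "'a::semiring_0 mat"
  assumes A: "A \<in> carrier_mat n n" "upper_triangular A"
    and B: "B \<in> carrier_mat n n" "upper_triangular B"
    and ij: "j \<le> i" "i < n"
  shows "(A * B) $$ (i,j) = (if i = j then A $$ (i,i) * B $$ (i,i) else 0)"
proof -
  have "(A * B) $$ (i,j) = (\<Sum>k<n. A $$ (i,k) * B $$ (k,j))"
    using index_mult_mat_sum[of A n n B n i j] A B ij by simp
  also have "\<dots> = (\<Sum>k<n. if k = i then (if i = j then A $$ (i,i) * B $$ (i,i) else 0) else 0)"
  proof (intro sum.cong refl)
    fix k assume "k \<in> {..<n}"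
    then show "A $$ (i,k) * B $$ (k,j)
        = (if k = i then (if i = j then A $$ (i,i) * B $$ (i,i) else 0) else 0)"
      using A B ij upper_triangularD[of A k i] upper_triangularD[of B j k]
      by (cases k i rule: linorder_cases) auto
  qed
  finally show ?thesis using ij by simp
qed

definition last_rows :: "nat \<Rightarrow> (nat \<Rightarrow> 'a mat) \<Rightarrow> 'a::zero mat" where
  "last_rows n B = Matrix.mat n n (\<lambda>(k,i). if i \<le> k then B (Suc k) $$ (k,i) else 0)"

lemma last_rows_carrier [simp]: "last_rows n B \<in> carrier_mat n n"
  by (simp add: last_rows_def)

lemma index_last_rows:
  "k < n \<Longrightarrow> i < n \<Longrightarrow> last_rows n B $$ (k,i) = (if i \<le> k then B (Suc k) $$ (k,i) else 0)"
  by (simp add: last_rows_def)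

lemma sum_last_rows:
  fixes f :: "nat \<Rightarrow> 'a::semiring_0"
  assumes "k < n"
  shows "(\<Sum>i<n. last_rows n B $$ (k,i) * f i) = (\<Sum>i<Suc k. B (Suc k) $$ (k,i) * f i)"
  by (rule sum.mono_neutral_cong_right) (use assms in \<open>auto simp: index_last_rows\<close>)

lemma upper_triangular_transpose_last_rows: "upper_triangular (transpose_mat (last_rows n B))"
  by (rule upper_triangularI) (auto simp: last_rows_def)

locale stable_leading_sections =
  fixes n :: nat and M :: "real mat" and B :: "nat \<Rightarrow> real mat" and C \<gamma> :: real
  assumes C_pos: "0 < C" and \<gamma>_pos: "0 < \<gamma>"
    and M_carrier: "M \<in> carrier_mat n n" and M_norm: "spec_norm M \<le> C"
    and B_inverse: "j \<in> {1..n} \<Longrightarrow> is_inverse_of (B j) (ul_sub M j)"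
    and B_norm: "j \<in> {1..n} \<Longrightarrow> spec_norm (B j) \<le> 1 / \<gamma>"
begin

lemma B_carrier: "j \<in> {1..n} \<Longrightarrow> B j \<in> carrier_mat j j"
  and B_right: "j \<in> {1..n} \<Longrightarrow> ul_sub M j * B j = 1\<^sub>m j"
  and B_left: "j \<in> {1..n} \<Longrightarrow> B j * ul_sub M j = 1\<^sub>m j"
  using B_inverse is_inverse_of_iff[OF ul_sub_carrier] by auto

sublocale stable_sections "\<lambda>l i. M $$ (l,i)" n C \<gamma>
proof
  fix x :: "nat \<Rightarrow> real"
  have "L2_set (\<lambda>l. \<Sum>i<n. M $$ (l,i) * x i) {..<n} \<le> spec_norm M * L2_set x {..<n}"
    using vec_l2_mult_mat_vec_le[OF M_carrier, of "Matrix.vec n x"]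
    by (simp add: vec_l2_mult_mat_vec[OF M_carrier] vec_l2_eq_L2_set[of "Matrix.vec n x"]
        cong: L2_set_cong_simp)
  also have "\<dots> \<le> C * L2_set x {..<n}" using M_norm by (intro mult_right_mono) auto
  finally show "L2_set (\<lambda>l. \<Sum>i<n. M $$ (l,i) * x i) {..<n} \<le> C * L2_set x {..<n}" .
next
  fix x :: "nat \<Rightarrow> real" and k assume "k \<le> n"
  show "\<gamma> * L2_set x {..<k} \<le> L2_set (\<lambda>l. \<Sum>i<k. M $$ (l,i) * x i) {..<k}"
  proof (cases "k = 0")
    case False
    with \<open>k \<le> n\<close> have k: "k \<in> {1..n}" by simp
    let ?x = "Matrix.vec k x"
    have "vec_l2 ?x \<le> spec_norm (B k) * vec_l2 (ul_sub M k *\<^sub>v ?x)"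
      by (rule vec_l2_le_left_inverse[OF B_carrier[OF k] ul_sub_carrier B_left[OF k]]) simp
    also have "\<dots> \<le> 1 / \<gamma> * vec_l2 (ul_sub M k *\<^sub>v ?x)"
      using B_norm[OF k] by (intro mult_right_mono vec_l2_nonneg)
    also have "vec_l2 (ul_sub M k *\<^sub>v ?x) = L2_set (\<lambda>l. \<Sum>i<k. M $$ (l,i) * x i) {..<k}"
      unfolding vec_l2_mult_mat_vec[OF ul_sub_carrier]
      by (intro L2_set_cong refl) (simp add: ul_sub_def)
    finally show ?thesis
      using \<gamma>_pos by (simp add: vec_l2_eq_L2_set field_simps cong: L2_set_cong_simp)
  qed simp
qed (rule C_pos \<gamma>_pos)+

lemma index_last_rows_mult:
  assumes "j \<le> k" "k < n"
  shows "(last_rows n B * M) $$ (k,j) = (if k = j then 1 else 0)"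
proof -
  have k: "Suc k \<in> {1..n}" using assms by simp
  have "(last_rows n B * M) $$ (k,j) = (\<Sum>i<n. last_rows n B $$ (k,i) * M $$ (i,j))"
    using assms by (intro index_mult_mat_sum[OF last_rows_carrier M_carrier]) auto
  also have "\<dots> = (\<Sum>i<Suc k. B (Suc k) $$ (k,i) * ul_sub M (Suc k) $$ (i,j))"
    unfolding sum_last_rows[OF \<open>k < n\<close>] using assms by (intro sum.cong) (auto simp: ul_sub_def)
  also have "\<dots> = (B (Suc k) * ul_sub M (Suc k)) $$ (k,j)"
    using assms by (intro index_mult_mat_sum[OF B_carrier[OF k] ul_sub_carrier, symmetric]) auto
  also have "\<dots> = (if k = j then 1 else 0)" using assms by (simp add: B_left[OF k])
  finally show ?thesis .
qed

lemma last_rows_mult_carrier: "last_rows n B * M \<in> carrier_mat n n"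
  by (rule mult_carrier_mat[OF last_rows_carrier M_carrier])

lemma upper_triangular_last_rows_mult: "upper_triangular (last_rows n B * M)"
proof (rule upper_triangularI)
  fix i j assume "j < i" "i < dim_row (last_rows n B * M)"
  then show "(last_rows n B * M) $$ (i,j) = 0"
    using last_rows_mult_carrier by (subst index_last_rows_mult) auto
qed

lemma sum_section_solution:
  assumes "l \<le> k" "k < n"
  shows "(\<Sum>i<Suc k. M $$ (l,i) * vec_index (B (Suc k) *\<^sub>v vec_first v (Suc k)) i) = vec_index v l"
proof -
  let ?v = "vec_first v (Suc k)" and ?A = "ul_sub M (Suc k)"
  have k: "Suc k \<in> {1..n}" using assms by simp
  have y: "B (Suc k) *\<^sub>v ?v \<in> carrier_vec (Suc k)"
    by (intro mult_mat_vec_carrier[OF B_carrier[OF k]]) simp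
  have "?A *\<^sub>v (B (Suc k) *\<^sub>v ?v) = ?v"
    by (subst assoc_mult_mat_vec[OF ul_sub_carrier B_carrier[OF k], symmetric])
      (simp_all add: B_right[OF k])
  then have "vec_index v l = vec_index (?A *\<^sub>v (B (Suc k) *\<^sub>v ?v)) l"
    using assms by (simp add: vec_first_def)
  also have "\<dots> = (\<Sum>i<Suc k. ?A $$ (l,i) * vec_index (B (Suc k) *\<^sub>v ?v) i)"
    using assms by (intro index_mult_mat_vec_sum[OF ul_sub_carrier y]) simp
  also have "\<dots> = (\<Sum>i<Suc k. M $$ (l,i) * vec_index (B (Suc k) *\<^sub>v ?v) i)"
    using assms by (intro sum.cong) (auto simp: ul_sub_def)
  finally show ?thesis ..
qed

lemma index_last_rows_mult_vec:
  assumes v: "v \<in> carrier_vec n" and k: "k < n"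
  shows "vec_index (last_rows n B *\<^sub>v v) k = vec_index (B (Suc k) *\<^sub>v vec_first v (Suc k)) k"
proof -
  have "vec_index (last_rows n B *\<^sub>v v) k = (\<Sum>i<Suc k. B (Suc k) $$ (k,i) * vec_index v i)"
    by (simp only: index_mult_mat_vec_sum[OF last_rows_carrier v k] sum_last_rows[OF k])
  also have "\<dots> = (\<Sum>i<Suc k. B (Suc k) $$ (k,i) * vec_index (vec_first v (Suc k)) i)"
    by (intro sum.cong) (auto simp: vec_first_def)
  also have "\<dots> = vec_index (B (Suc k) *\<^sub>v vec_first v (Suc k)) k"
    using k B_carrier[of "Suc k"]
    by (intro index_mult_mat_vec_sum[where n = "Suc k", symmetric]) auto
  finally show ?thesis .
qed

lemma spec_norm_last_rows_le:
  assumes e: "0 < e" "e \<le> 1 / 4" "16 * C * e \<le> \<gamma>"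
  shows "spec_norm (last_rows n B) \<le> 4 / \<gamma> * real n powr (1 / 2 - e)"
proof (rule spec_norm_least[OF last_rows_carrier])
  fix v :: "real Matrix.vec" assume v: "v \<in> carrier_vec n"
  define Y where
    "Y i k = (if i \<le> k then vec_index (B (Suc k) *\<^sub>v vec_first v (Suc k)) i else 0)" for i k
  have galerkin: "(\<Sum>i<n. M $$ (l,i) * Y i k) = vec_index v l" if "l \<le> k" "k < n" for l k
  proof -
    have "(\<Sum>i<n. M $$ (l,i) * Y i k)
        = (\<Sum>i<Suc k. M $$ (l,i) * vec_index (B (Suc k) *\<^sub>v vec_first v (Suc k)) i)"
      by (rule sum.mono_neutral_cong_right) (use that in \<open>auto simp: Y_def\<close>)
    then show ?thesis by (simp only: sum_section_solution[OF that])
  qed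
  have "vec_l2 (last_rows n B *\<^sub>v v) = L2_set (\<lambda>k. Y k k) {..<n}"
    unfolding vec_l2_eq_L2_set using carrier_matD(1)[OF last_rows_carrier[of n B]]
    by (intro L2_set_cong)
      (auto simp: index_last_rows_mult_vec[OF v] Y_def simp del: index_mult_mat_vec)
  also have "\<dots> \<le> 4 / \<gamma> * real n powr (1 / 2 - e) * L2_set (vec_index v) {..<n}"
    by (rule L2_set_galerkin_diagonal_le[OF e _ galerkin]) (simp_all add: Y_def)
  finally show "vec_l2 (last_rows n B *\<^sub>v v) \<le> 4 / \<gamma> * real n powr (1 / 2 - e) * vec_l2 v"
    using v by (simp add: vec_l2_eq_L2_set)
qed (use \<gamma>_pos in simp)

lemma inverse_corner_lower_bound:
  assumes "k < n"
  shows "1 \<le> C * (1 + C / \<gamma>) * \<bar>B (Suc k) $$ (k,k)\<bar>"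
proof -
  have k: "Suc k \<in> {1..n}" using assms by simp
  define x where "x i = (if i \<le> k then B (Suc k) $$ (i,k) else 0)" for i
  have "(\<Sum>i<n. M $$ (l,i) * x i) = (if l = k then 1 else 0)" if "l \<le> k" for l
  proof -
    have "(\<Sum>i<n. M $$ (l,i) * x i) = (\<Sum>i<Suc k. ul_sub M (Suc k) $$ (l,i) * B (Suc k) $$ (i,k))"
      by (rule sum.mono_neutral_cong_right) (use that assms in \<open>auto simp: x_def ul_sub_def\<close>)
    also have "\<dots> = (ul_sub M (Suc k) * B (Suc k)) $$ (l,k)"
      using that by (intro index_mult_mat_sum[OF ul_sub_carrier B_carrier[OF k], symmetric]) auto
    finally show ?thesis using that by (simp add: B_right[OF k])
  qed
  then have "1 \<le> C * (1 + C / \<gamma>) * \<bar>x k\<bar>"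
    by (intro last_entry_lower_bound assms) (simp_all add: x_def)
  then show ?thesis by (simp add: x_def)
qed

lemma stable_leading_sections_transpose:
  "stable_leading_sections n (transpose_mat M) (\<lambda>j. transpose_mat (B j)) C \<gamma>"
proof
  show "is_inverse_of (transpose_mat (B j)) (ul_sub (transpose_mat M) j)" if "j \<in> {1..n}" for j
    using is_inverse_of_transpose[OF ul_sub_carrier B_inverse[OF that]] that
    by (simp add: ul_sub_transpose[OF M_carrier])
qed (use C_pos \<gamma>_pos M_carrier M_norm B_norm in \<open>simp_all add: spec_norm_transpose\<close>)

interpretation transpose: stable_leading_sections n "transpose_mat M" "\<lambda>j. transpose_mat (B j)" C \<gamma>
  by (rule stable_leading_sections_transpose)

definition pivots :: "real mat" where
  "pivots = mat_diag n (\<lambda>k. 1 / B (Suc k) $$ (k,k))"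

definition upper_inverse :: "real mat" where
  "upper_inverse = transpose_mat (last_rows n (\<lambda>j. transpose_mat (B j)))"

definition lower_factor :: "real mat" where
  "lower_factor = M * upper_inverse"

definition lower_inverse :: "real mat" where
  "lower_inverse = pivots * last_rows n B"

definition upper_factor :: "real mat" where
  "upper_factor = lower_inverse * M"

lemma pivots_carrier: "pivots \<in> carrier_mat n n"
  by (simp add: pivots_def)

lemma upper_inverse_carrier: "upper_inverse \<in> carrier_mat n n"
  by (simp add: upper_inverse_def)

lemma lower_factor_carrier: "lower_factor \<in> carrier_mat n n"
  using M_carrier upper_inverse_carrier by (simp add: lower_factor_def)

lemma lower_inverse_carrier: "lower_inverse \<in> carrier_mat n n"
  using pivots_carrier by (simp add: lower_inverse_def)

lemma upper_factor_carrier: "upper_factor \<in> carrier_mat n n"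
  using M_carrier lower_inverse_carrier by (simp add: upper_factor_def)

lemma transpose_lower_factor:
  "transpose_mat lower_factor = last_rows n (\<lambda>j. transpose_mat (B j)) * transpose_mat M"
  unfolding lower_factor_def transpose_mult[OF M_carrier upper_inverse_carrier]
  by (simp add: upper_inverse_def)

lemma index_lower_factor:
  assumes "l \<le> j" "j < n"
  shows "lower_factor $$ (l,j) = (if l = j then 1 else 0)"
proof -
  have "lower_factor $$ (l,j) = transpose_mat lower_factor $$ (j,l)"
    using assms lower_factor_carrier by simp
  then show ?thesis
    using transpose.index_last_rows_mult[OF assms] by (auto simp: transpose_lower_factor)
qed

lemma upper_triangular_transpose_lower_factor: "upper_triangular (transpose_mat lower_factor)"
  unfolding transpose_lower_factor by (rule transpose.upper_triangular_last_rows_mult)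

lemma index_upper_inverse_diagonal: "k < n \<Longrightarrow> upper_inverse $$ (k,k) = B (Suc k) $$ (k,k)"
  using B_carrier[of "Suc k"] by (simp add: upper_inverse_def last_rows_def)

lemma last_rows_mult_lower_factor:
  "last_rows n B * lower_factor = mat_diag n (\<lambda>k. B (Suc k) $$ (k,k))" (is "?R * _ = ?D")
proof (rule eq_matI)
  fix i j assume "i < dim_row ?D" "j < dim_col ?D"
  then have i: "i < n" and j: "j < n" by (simp_all add: mat_diag_def)
  show "(?R * lower_factor) $$ (i,j) = ?D $$ (i,j)"
  proof (cases "j \<le> i")
    case True
    have "?R * lower_factor = (?R * M) * upper_inverse"
      unfolding lower_factor_def
      by (rule assoc_mult_mat[OF last_rows_carrier M_carrier upper_inverse_carrier, symmetric])
    moreover have "upper_triangular upper_inverse"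
      unfolding upper_inverse_def by (rule upper_triangular_transpose_last_rows)
    ultimately show ?thesis
      using i j True
      by (simp add: index_mult_upper_triangular[OF last_rows_mult_carrier
            upper_triangular_last_rows_mult upper_inverse_carrier]
          index_last_rows_mult index_upper_inverse_diagonal mat_diag_def del: index_mult_mat)
  next
    case False
    then have "i \<le> j" by simp
    have "(?R * lower_factor) $$ (i,j) = transpose_mat (?R * lower_factor) $$ (j,i)"
      using i j lower_factor_carrier carrier_matD(1)[OF last_rows_carrier[of n B]] by simp
    also have "transpose_mat (?R * lower_factor) = transpose_mat lower_factor * transpose_mat ?R"
      by (rule transpose_mult[OF last_rows_carrier lower_factor_carrier])
    also have "\<dots> $$ (j,i) = 0"
      using False \<open>i \<le> j\<close> j lower_factor_carrier
      by (subst index_mult_upper_triangular[where n = n])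
        (auto intro: upper_triangular_transpose_lower_factor upper_triangular_transpose_last_rows)
    finally show ?thesis using False i j by (simp add: mat_diag_def)
  qed
qed (use lower_factor_carrier in \<open>auto simp: mat_diag_def last_rows_def\<close>)

lemma lower_inverse_mult_lower_factor: "lower_inverse * lower_factor = 1\<^sub>m n"
proof -
  have "B (Suc k) $$ (k,k) \<noteq> 0" if "k < n" for k using inverse_corner_lower_bound[OF that] by auto
  then have "mat_diag n (\<lambda>k. 1 / B (Suc k) $$ (k,k) * B (Suc k) $$ (k,k)) = 1\<^sub>m n"
    by (intro eq_matI) (auto simp: mat_diag_def)
  then have "pivots * mat_diag n (\<lambda>k. B (Suc k) $$ (k,k)) = 1\<^sub>m n"
    by (simp only: pivots_def mat_diag_diag)
  then show ?thesis
    by (simp add: lower_inverse_def last_rows_mult_lower_factor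
        assoc_mult_mat[OF pivots_carrier last_rows_carrier lower_factor_carrier])
qed

lemma is_inverse_of_lower_factor: "is_inverse_of lower_inverse lower_factor"
  unfolding is_inverse_of_iff[OF lower_factor_carrier]
  by (intro conjI lower_inverse_carrier lower_inverse_mult_lower_factor
      mat_mult_left_right_inverse[OF lower_inverse_carrier lower_factor_carrier])

lemma LU_decomposition: "M = lower_factor * upper_factor"
  using is_inverse_of_lower_factor M_carrier unfolding is_inverse_of_iff[OF lower_factor_carrier]
  by (simp add: upper_factor_def
      assoc_mult_mat[OF lower_factor_carrier lower_inverse_carrier M_carrier, symmetric])

lemma is_inverse_of_upper_factor: "is_inverse_of upper_inverse upper_factor"
proof -
  have "upper_factor * upper_inverse = 1\<^sub>m n"
    unfolding upper_factor_def
      assoc_mult_mat[OF lower_inverse_carrier M_carrier upper_inverse_carrier]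
    by (simp add: lower_inverse_mult_lower_factor flip: lower_factor_def)
  then show ?thesis
    unfolding is_inverse_of_iff[OF upper_factor_carrier]
    by (intro conjI upper_inverse_carrier
        mat_mult_left_right_inverse[OF upper_factor_carrier upper_inverse_carrier])
qed

lemma unit_lower_triangular_lower_factor: "unit_lower_triangular lower_factor"
  using lower_factor_carrier by (auto simp: unit_lower_triangular_def index_lower_factor)

lemma upper_triangular_upper_factor: "upper_triangular upper_factor"
proof (rule upper_triangularI)
  fix i j assume ij: "j < i" "i < dim_row upper_factor"
  have "upper_factor = pivots * (last_rows n B * M)"
    unfolding upper_factor_def lower_inverse_def
    by (rule assoc_mult_mat[OF pivots_carrier last_rows_carrier M_carrier])
  then show "upper_factor $$ (i,j) = 0"
    using ij upper_factor_carrier index_last_rows_mult[of j i] last_rows_mult_carrier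
    by (simp add: pivots_def mat_diag_mult_left[of _ n n] del: index_mult_mat(1))
qed

lemma spec_norm_pivots_le: "spec_norm pivots \<le> C * (1 + C / \<gamma>)"
  unfolding pivots_def
proof (rule spec_norm_mat_diag_le)
  fix k assume "k < n"
  with inverse_corner_lower_bound[OF this] show "\<bar>1 / B (Suc k) $$ (k,k)\<bar> \<le> C * (1 + C / \<gamma>)"
    by (cases "B (Suc k) $$ (k,k) = 0") (simp_all add: pos_divide_le_eq)
qed (use C_pos \<gamma>_pos in simp)

lemma spec_norm_factors_le:
  assumes e: "0 < e" "e \<le> 1 / 4" "16 * C * e \<le> \<gamma>"
  shows "spec_norm lower_factor + spec_norm upper_factor + spec_norm lower_inverse
      + spec_norm upper_inverse
    \<le> 4 / \<gamma> * (1 + C) * (1 + C * (1 + C / \<gamma>)) * real n powr (1 / 2 - e)"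
proof -
  define \<beta> where "\<beta> = 4 / \<gamma> * real n powr (1 / 2 - e)"
  define K where "K = C * (1 + C / \<gamma>)"
  have K: "K \<ge> 0" using C_pos \<gamma>_pos by (simp add: K_def)
  have upper_inverse: "spec_norm upper_inverse \<le> \<beta>"
    unfolding upper_inverse_def spec_norm_transpose \<beta>_def
    by (rule transpose.spec_norm_last_rows_le[OF e])
  have "spec_norm lower_factor \<le> spec_norm M * spec_norm upper_inverse"
    unfolding lower_factor_def by (rule spec_norm_mult_le[OF M_carrier upper_inverse_carrier])
  also have "\<dots> \<le> C * \<beta>"
    using M_norm upper_inverse C_pos by (intro mult_mono spec_norm_nonneg) auto
  finally have lower_factor: "spec_norm lower_factor \<le> C * \<beta>" .
  have "spec_norm lower_inverse \<le> spec_norm pivots * spec_norm (last_rows n B)"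
    unfolding lower_inverse_def by (rule spec_norm_mult_le[OF pivots_carrier last_rows_carrier])
  also have "\<dots> \<le> K * \<beta>"
    unfolding \<beta>_def using K spec_norm_pivots_le spec_norm_last_rows_le[OF e]
    by (intro mult_mono spec_norm_nonneg) (auto simp: K_def)
  finally have lower_inverse: "spec_norm lower_inverse \<le> K * \<beta>" .
  have "spec_norm upper_factor \<le> spec_norm lower_inverse * spec_norm M"
    unfolding upper_factor_def by (rule spec_norm_mult_le[OF lower_inverse_carrier M_carrier])
  also have "\<dots> \<le> K * \<beta> * C"
    using lower_inverse M_norm spec_norm_nonneg order_trans
    by (intro mult_mono) blast+
  finally have "spec_norm lower_factor + spec_norm upper_factor + spec_norm lower_inverse
      + spec_norm upper_inverse \<le> (1 + C) * (1 + K) * \<beta>"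
    using upper_inverse lower_factor lower_inverse by (simp add: algebra_simps)
  then show ?thesis unfolding K_def \<beta>_def by (simp only: mult_ac)
qed

lemma ex_LU_factorization:
  assumes e: "0 < e" "e \<le> 1 / 4" "16 * C * e \<le> \<gamma>"
  shows "\<exists>L U Linv Uinv. L \<in> carrier_mat n n \<and> U \<in> carrier_mat n n \<and> M = L * U \<and>
         unit_lower_triangular L \<and> upper_triangular U \<and>
         is_inverse_of Linv L \<and> is_inverse_of Uinv U \<and>
         spec_norm L + spec_norm U + spec_norm Linv + spec_norm Uinv
           \<le> 4 / \<gamma> * (1 + C) * (1 + C * (1 + C / \<gamma>)) * real n powr (1 / 2 - e)"
  using lower_factor_carrier upper_factor_carrier LU_decomposition
    unit_lower_triangular_lower_factor upper_triangular_upper_factor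
    is_inverse_of_lower_factor is_inverse_of_upper_factor spec_norm_factors_le[OF e]
  by blast

end

theorem mainTheorem8:
  fixes C \<gamma> :: real
  assumes "C > 0" and "\<gamma> > 0"
  shows "\<exists>C_LU p. C_LU > 0 \<and> p > 2 \<and>
    (\<forall>(n::nat) (M::real mat). M \<in> carrier_mat n n \<longrightarrow> spec_norm M \<le> C \<longrightarrow>
      (\<forall>j\<in>{1..n}. \<exists>B. is_inverse_of B (ul_sub M j) \<and> spec_norm B \<le> 1 / \<gamma>) \<longrightarrow>
      (\<exists>L U Linv Uinv. L \<in> carrier_mat n n \<and> U \<in> carrier_mat n n \<and> M = L * U \<and>
         unit_lower_triangular L \<and> upper_triangular U \<and>
         is_inverse_of Linv L \<and> is_inverse_of Uinv U \<and>
         spec_norm L + spec_norm U + spec_norm Linv + spec_norm Uinv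
           \<le> C_LU * real n powr (1 / p)))"
proof -
  define e where "e = min (1 / 4) (\<gamma> / (16 * C))"
  have e: "0 < e" "e \<le> 1 / 4" "16 * C * e \<le> \<gamma>"
    using assms by (auto simp: e_def min_def field_simps)
  show ?thesis
  proof (rule exI[of _ "4 / \<gamma> * (1 + C) * (1 + C * (1 + C / \<gamma>))"],
      rule exI[of _ "1 / (1 / 2 - e)"], intro conjI allI impI, goal_cases)
    case 1
    show ?case using assms by (simp add: add_pos_pos)
  next
    case 2
    show ?case using e by (simp add: field_simps)
  next
    case (3 n M)
    then obtain B where "\<forall>j\<in>{1..n}. is_inverse_of (B j) (ul_sub M j) \<and> spec_norm (B j) \<le> 1 / \<gamma>"
      by metis
    then interpret stable_leading_sections n M B C \<gamma>
      using assms 3 by unfold_locales auto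
    show ?case using ex_LU_factorization[OF e] by simp
  qed
qed

end
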